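(* For every $p\in[1,\infty]$, $$R_{\max}^{\mathrm{CN}}(p) = R_{\max}^{\mathrm{NN}}(p) = \|(2,1)\|_p .$$
   Context: Norms: for $Q=(x,y)\in\mathbb{R}^2$, $\|Q\|_p=(|x|^p+|y|^p)^{1/p}$ if $p\in[1,\infty)$ and $\|Q\|_\infty=\max\{|x|,|y|\}$. Point collections: $\mathcal{P}=\prod_{(i,j)\in\mathbb{Z}^2}[i,i+1]\times[j,j+1]$. An element is a family $P=(P_{i,j})_{(i,j)\in\mathbb{Z}^2}$ with $P_{i,j}\in[i,i+1]\times[j,j+1]$. Complete neighbor model: for $P\in\mathcal{P}$ and $R>0$, $\Gamma_{p,R}^{\mathrm{CN}}(P)$ is the undirected graph with vertex set $\mathbb{Z}^2$ and edge set $E_{p,R}^{\mathrm{CN}}(P)=\{(u,v)\in\mathbb{Z}^2\times\mathbb{Z}^2: u\neq v,\ \|P_u-P_v\|_p\le R\}$. Nearest neighbor model: $\Gamma_{p,R}^{\mathrm{NN}}(P)$ is the undirected graph with vertex set $\mathbb{Z}^2$ and edge set $E_{p,R}^{\mathrm{NN}}(P)=E_{p,R}^{\mathrm{CN}}(P)\cap\{(u,v):\|u-v\|_1=1\}$. For a graph $G$ on $\mathbb{Z}^2$, $\mathcal{C}_0(G)$ is the connected component of $(0,0)$, i.e. the set of vertices connected to $(0,0)$ by a finite path of $G$. Total connectivity radius: for $\ast\in\{\mathrm{CN},\mathrm{NN}\}$, $R_{\max}^{\ast}(p)=\inf\{R>0:\ \forall P\in\mathcal{P},\ |\mathcal{C}_0(\Gamma_{p,R}^{\ast}(P))|=\infty\}$.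 *)

theory Defs
  imports "HOL-Analysis.Analysis"
begin

(* Intended for 1 \<le> p \<le> \<infinity>. *)
definition lp_norm :: "ereal \<Rightarrow> real \<times> real \<Rightarrow> real" where
  "lp_norm p Q =
     (if p = \<infinity> then max \<bar>fst Q\<bar> \<bar>snd Q\<bar>
      else (\<bar>fst Q\<bar> powr real_of_ereal p + \<bar>snd Q\<bar> powr real_of_ereal p)
             powr (1 / real_of_ereal p))"

definition point_collections :: "(int \<times> int \<Rightarrow> real \<times> real) set" where
  "point_collections =
     {P. \<forall>i j. P (i, j) \<in> {real_of_int i .. real_of_int i + 1} \<times> {real_of_int j .. real_of_int j + 1}}"

(* A graph with vertex set \<int>\<^sup>2 is represented by its (symmetric) set of ordered
   pairs of adjacent vertices; the vertex set is the whole type int \<times> int. *)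
type_synonym lattice_graph = "((int \<times> int) \<times> (int \<times> int)) set"

definition CN_graph :: "ereal \<Rightarrow> real \<Rightarrow> (int \<times> int \<Rightarrow> real \<times> real) \<Rightarrow> lattice_graph" where
  "CN_graph p R P = {(u, v). u \<noteq> v \<and> lp_norm p (P u - P v) \<le> R}"

definition NN_graph :: "ereal \<Rightarrow> real \<Rightarrow> (int \<times> int \<Rightarrow> real \<times> real) \<Rightarrow> lattice_graph" where
  "NN_graph p R P =
     CN_graph p R P \<inter>
     {(u, v). lp_norm 1 (real_of_int (fst u - fst v), real_of_int (snd u - snd v)) = 1}"

definition origin_component :: "lattice_graph \<Rightarrow> (int \<times> int) set" where
  "origin_component G = {v. ((0, 0), v) \<in> G\<^sup>*}"

(* The infimum is taken in the extended reals, so that the infimum of the empty set is \<infinity>. *)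
definition R_max ::
    "(real \<Rightarrow> (int \<times> int \<Rightarrow> real \<times> real) \<Rightarrow> lattice_graph) \<Rightarrow> ereal" where
  "R_max \<Gamma> =
     Inf {ereal R | R. R > 0 \<and> (\<forall>P\<in>point_collections. infinite (origin_component (\<Gamma> R P)))}"

definition R_max_CN :: "ereal \<Rightarrow> ereal" where
  "R_max_CN p = R_max (CN_graph p)"

definition R_max_NN :: "ereal \<Rightarrow> ereal" where
  "R_max_NN p = R_max (NN_graph p)"

end

theory Submission
  imports Defs
begin

(* Points of adjacent cells differ by at most (2,1) or (1,2) in absolute value, so for R at least
   the norm of (2,1) every edge of the square lattice is present. Conversely, send the four cells
   around the lattice point (1,1) to that point and every other cell to its corner farthest from
   (1,1): the differences from (1,1) then dominate (2,1) or (1,2), so for smaller R the component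
   of the origin lies inside the block of four cells. *)

text \<open>Reduces the norm estimates below to comparing coordinates with (2,1). For finite p, both
  powers involved, with exponents r and 1/r, are monotone on nonnegative reals.\<close>

lemma lp_norm_mono:
  fixes p :: ereal
  assumes "1 \<le> p" "\<bar>fst x\<bar> \<le> \<bar>fst y\<bar>" "\<bar>snd x\<bar> \<le> \<bar>snd y\<bar>"
  shows "lp_norm p x \<le> lp_norm p y"
proof (cases p)
  case (real r)
  then have "1 \<le> r" using assms(1) by simp
  then show ?thesis
    using real assms(2,3) by (auto simp: lp_norm_def intro!: powr_mono2 add_mono)
qed (use assms in \<open>auto simp: lp_norm_def max_def\<close>)

lemma lp_norm_swap: "lp_norm p (a, b) = lp_norm p (b, a)"
  by (simp add: lp_norm_def max.commute add.commute)

text \<open>Ensures that the threshold radius meets the constraint \<open>R > 0\<close> inside the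
  infimum.\<close>

lemma lp_norm_pos:
  assumes "fst x \<noteq> 0"
  shows "0 < lp_norm p x"
proof -
  have "0 < \<bar>fst x\<bar> powr r + \<bar>snd x\<bar> powr r" for r
    using assms by (intro add_pos_nonneg) auto
  then have "0 < (\<bar>fst x\<bar> powr r + \<bar>snd x\<bar> powr r) powr (1 / r)" for r
    by (metis less_irrefl powr_gt_zero)
  then show ?thesis
    using assms by (simp add: lp_norm_def less_max_iff_disj)
qed

lemma point_collections_bounds:
  assumes "P \<in> point_collections"
  shows "real_of_int i \<le> fst (P (i, j))" "fst (P (i, j)) \<le> real_of_int i + 1"
    "real_of_int j \<le> snd (P (i, j))" "snd (P (i, j)) \<le> real_of_int j + 1"
proof -
  have "P (i, j) \<in> {real_of_int i .. real_of_int i + 1} \<times> {real_of_int j .. real_of_int j + 1}"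
    using assms unfolding point_collections_def by blast
  then show "real_of_int i \<le> fst (P (i, j))" "fst (P (i, j)) \<le> real_of_int i + 1"
    "real_of_int j \<le> snd (P (i, j))" "snd (P (i, j)) \<le> real_of_int j + 1"
    by (auto simp: mem_Times_iff)
qed

lemma NN_graph_horizontal_edge:
  assumes "1 \<le> p" "P \<in> point_collections" "lp_norm p (2, 1) \<le> R"
  shows "((i, j), (i + 1, j)) \<in> NN_graph p R P"
proof -
  have "lp_norm p (P (i, j) - P (i + 1, j)) \<le> lp_norm p (2, 1)"
    using point_collections_bounds[OF assms(2), where i = i and j = j]
      point_collections_bounds[OF assms(2), where i = "i + 1" and j = j]
    by (intro lp_norm_mono assms(1)) auto
  moreover have "lp_norm 1 (- 1, 0) = 1"
    by (simp add: lp_norm_def)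
  ultimately show ?thesis
    using assms(3) by (simp add: NN_graph_def CN_graph_def)
qed

text \<open>Horizontal edges alone join the origin to every vertex of the ray (n, 0), n \<ge>
  0.\<close>

lemma infinite_origin_component_NN:
  assumes "1 \<le> p" "P \<in> point_collections" "lp_norm p (2, 1) \<le> R"
  shows "infinite (origin_component (NN_graph p R P))"
proof -
  have "((0, 0), (int n, 0)) \<in> (NN_graph p R P)\<^sup>*" for n
  proof (induction n)
    case (Suc n)
    then show ?case
      using NN_graph_horizontal_edge[OF assms, of "int n" 0]
      by (simp add: add.commute rtrancl.rtrancl_into_rtrancl)
  qed simp
  then have "range (\<lambda>n. (int n, 0)) \<subseteq> origin_component (NN_graph p R P)"
    by (auto simp: origin_component_def)
  moreover have "infinite (range (\<lambda>n. (int n, 0 :: int)))"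
    by (intro range_inj_infinite) (simp add: inj_def)
  ultimately show ?thesis
    using infinite_super by blast
qed

lemma origin_component_mono: "G \<subseteq> H \<Longrightarrow> origin_component G \<subseteq> origin_component H"
  unfolding origin_component_def using rtrancl_mono by blast

lemma NN_graph_subset_CN_graph: "NN_graph p R P \<subseteq> CN_graph p R P"
  by (simp add: NN_graph_def)

text \<open>The endpoint of [i, i+1] farther from 1.\<close>

definition far_coord :: "int \<Rightarrow> real" where
  "far_coord i = (if 1 \<le> i then real_of_int i + 1 else real_of_int i)"

definition isolating_collection :: "int \<times> int \<Rightarrow> real \<times> real" where
  "isolating_collection u =
     (if u \<in> {0, 1} \<times> {0, 1} then (1, 1) else (far_coord (fst u), far_coord (snd u)))"

lemma isolating_collection_mem: "isolating_collection \<in> point_collections"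
  by (auto simp: point_collections_def isolating_collection_def far_coord_def)

lemma far_coord_dist: "1 \<le> \<bar>1 - far_coord i\<bar>" "i \<notin> {0, 1} \<Longrightarrow> 2 \<le> \<bar>1 - far_coord i\<bar>"
  by (auto simp: far_coord_def)

lemma isolating_collection_dist:
  assumes "1 \<le> p" "u \<in> {0, 1} \<times> {0, 1}" "v \<notin> {0, 1} \<times> {0, 1}"
  shows "lp_norm p (2, 1) \<le> lp_norm p (isolating_collection u - isolating_collection v)"
proof -
  have diff: "isolating_collection u - isolating_collection v
      = (1 - far_coord (fst v), 1 - far_coord (snd v))"
    unfolding isolating_collection_def using assms(2,3) by simp
  \<comment> \<open>An index outside {0, 1} puts its coordinate at distance at least 2 from 1; the
    other coordinate is always at distance at least 1.\<close>
  consider "fst v \<notin> {0, 1}" | "snd v \<notin> {0, 1}"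
    using assms(3) unfolding mem_Times_iff by blast
  then show ?thesis
  proof cases
    case 1
    then show ?thesis
      unfolding diff using far_coord_dist by (intro lp_norm_mono assms(1)) auto
  next
    case 2
    then show ?thesis
      \<comment> \<open>Here the difference dominates (1,2), which has the same norm as
        (2,1).\<close>
      unfolding diff lp_norm_swap[of p 2]
      using far_coord_dist by (intro lp_norm_mono assms(1)) auto
  qed
qed

lemma finite_origin_component_CN:
  assumes "1 \<le> p" "R < lp_norm p (2, 1)"
  shows "finite (origin_component (CN_graph p R isolating_collection))"
proof -
  have "v \<in> {0, 1} \<times> {0, 1}" if "((0, 0), v) \<in> (CN_graph p R isolating_collection)\<^sup>*" for v
    using that
  proof (induction rule: rtrancl_induct)
    case (step y z)
    then have "lp_norm p (isolating_collection y - isolating_collection z) \<le> R"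
      by (simp add: CN_graph_def)
    \<comment> \<open>An edge from y in the block to z outside it would have length at least the
      norm of (2,1), hence above R.\<close>
    with step.IH show ?case
      using isolating_collection_dist[OF assms(1), of y z] assms(2) by argo
  qed simp
  then have "origin_component (CN_graph p R isolating_collection) \<subseteq> {0, 1} \<times> {0, 1}"
    unfolding origin_component_def by blast
  then show ?thesis
    by (rule finite_subset) simp
qed

text \<open>The two conditions make the admissible radii exactly the closed ray from r, so the
  infimum is attained at r.\<close>

lemma R_max_eqI:
  assumes "0 < r"
    and "\<And>R P. r \<le> R \<Longrightarrow> P \<in> point_collections \<Longrightarrow> infinite (origin_component (\<Gamma> R P))"
    and "\<And>R. R < r \<Longrightarrow> \<exists>P\<in>point_collections. finite (origin_component (\<Gamma> R P))"
  shows "R_max \<Gamma> = ereal r"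
proof -
  have "R > 0 \<and> (\<forall>P\<in>point_collections. infinite (origin_component (\<Gamma> R P))) \<longleftrightarrow> r \<le> R" for R
    using assms(1) assms(2)[of R] assms(3)[of R] by (meson less_le_trans not_less)
  then have "{ereal R | R. R > 0 \<and> (\<forall>P\<in>point_collections. infinite (origin_component (\<Gamma> R P)))}
      = ereal ` {r..}"
    by auto
  also have "Inf \<dots> = ereal r"
    by (rule Inf_eqI) auto
  finally show ?thesis
    unfolding R_max_def .
qed

theorem theorem4:
  fixes p :: ereal
  assumes "1 \<le> p"
  shows "R_max_CN p = R_max_NN p \<and> R_max_NN p = ereal (lp_norm p (2, 1))"
proof -
  \<comment> \<open>Each bound is needed for one model only: infinite components pass from NN up to
    CN, finite ones from CN down to NN.\<close>
  note mono = origin_component_mono[OF NN_graph_subset_CN_graph]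
  have pos: "0 < lp_norm p (2, 1)"
    by (rule lp_norm_pos) simp
  have "R_max_CN p = ereal (lp_norm p (2, 1))"
    unfolding R_max_CN_def
  proof (rule R_max_eqI[OF pos])
    show "infinite (origin_component (CN_graph p R P))"
      if "lp_norm p (2, 1) \<le> R" "P \<in> point_collections" for R P
      using infinite_origin_component_NN[OF assms that(2,1)] infinite_super[OF mono] by blast
    show "\<exists>P\<in>point_collections. finite (origin_component (CN_graph p R P))"
      if "R < lp_norm p (2, 1)" for R
      using finite_origin_component_CN[OF assms that] isolating_collection_mem by (rule bexI)
  qed
  moreover have "R_max_NN p = ereal (lp_norm p (2, 1))"
    unfolding R_max_NN_def
  proof (rule R_max_eqI[OF pos])
    show "infinite (origin_component (NN_graph p R P))"
      if "lp_norm p (2, 1) \<le> R" "P \<in> point_collections" for R P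
      by (rule infinite_origin_component_NN[OF assms that(2,1)])
    show "\<exists>P\<in>point_collections. finite (origin_component (NN_graph p R P))"
      if "R < lp_norm p (2, 1)" for R
      using finite_subset[OF mono finite_origin_component_CN[OF assms that]]
        isolating_collection_mem by (rule bexI)
  qed
  ultimately show ?thesis
    by simp
qed

end
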